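(* Let $d\in\mathbb{N}$, $\alpha=(\alpha_1,\dots,\alpha_d)\in(0,1]^d$ and $A\in\mathbb{C}^{d\times d}$. Then, for each $x_0\in\mathbb{C}^d$, the initial value problem $$D_*^\alpha x(t)=Ax(t),\qquad x(0)=x_0,$$ has a uniquely determined solution in $C([0,\infty);\mathbb{C}^d)$. Moreover, for each $j\in\{1,\dots,d\}$ there are coefficients $b^{(j)}_{k,\ell_1,\dots,\ell_{j-1},\ell_{j+1},\dots,\ell_d}\in\mathbb{C}$ (for $k,\ell_\mu\in\{0,1,2,\dots\}$) such that the $j$-th component of this solution can be expressed, for all $t\ge0$, in the form $$x_j(t)=\sum_{k=0}^\infty\ \sum_{\ell_1,\dots,\ell_{j-1},\ell_{j+1},\dots,\ell_d=0}^\infty b^{(j)}_{k,\ell_1,\dots,\ell_{j-1},\ell_{j+1},\dots,\ell_d}\; t^{\,k\alpha_j+\sum_{\mu=1,\mu\ne j}^d\ell_\mu\alpha_\mu},$$ and this (multiple) series converges (absolutely) for all $t\ge0$.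
   Context: $D_*^\alpha x=(D_*^{\alpha_1}x_1,\dots,D_*^{\alpha_d}x_d)^\top$ denotes the componentwise Caputo derivative. By definition, a solution on $[0,\infty)$ of $D_*^\alpha x(t)=Ax(t)$, $x(0)=x_0$, with $A=(a_{ij})$, is a continuous function $x:[0,\infty)\to\mathbb{C}^d$ satisfying $$x_i(t)=x_i^0+\frac{1}{\Gamma(\alpha_i)}\int_0^t(t-s)^{\alpha_i-1}\sum_{j=1}^d a_{ij}x_j(s)\,ds\qquad\text{for all } t\ge0,\ i=1,\dots,d,$$ where $x_0=(x_1^0,\dots,x_d^0)^\top$. The convention $t^0=1$ (also for $t=0$) is used. *)

theory Defs
  imports "HOL-Analysis.Analysis"
begin

text \<open>
  The real power with the convention that the zeroth power of 0 is 1; the library has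
  \<open>0 powr 0 = 0\<close>. The values \<open>rpow 0 p = 0\<close> for \<open>p < 0\<close> only occur at the endpoint \<open>s = t\<close>
  of the integral below, where they do not affect the value.
\<close>
definition rpow :: "real \<Rightarrow> real \<Rightarrow> real" where
  "rpow t p = (if p = 0 then 1 else t powr p)"

definition RL_integral :: "real \<Rightarrow> (real \<Rightarrow> complex) \<Rightarrow> real \<Rightarrow> complex" where
  "RL_integral a f t =
     (1 / Gamma a) *\<^sub>R integral {0..t} (\<lambda>s. rpow (t - s) (a - 1) *\<^sub>R f s)"

text \<open>
  Solutions on \<open>[0,\<infinity>)\<close> of the Caputo initial value problem with componentwise orders
  \<open>\<alpha>\<close>, by definition the continuous solutions of the associated Volterra integral equation.
  For continuous \<open>x\<close> and orders in \<open>(0,1]\<close> the integrand is always absolutely integrable.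
  The values of \<open>x\<close> at negative arguments are irrelevant.
\<close>
definition caputo_ivp_solution ::
    "real ^ 'n \<Rightarrow> complex ^ 'n ^ 'n \<Rightarrow> complex ^ 'n \<Rightarrow> (real \<Rightarrow> complex ^ 'n) \<Rightarrow> bool" where
  "caputo_ivp_solution \<alpha> A x0 x \<longleftrightarrow>
     continuous_on {0..} x \<and>
     (\<forall>t\<ge>0. \<forall>i. x t $ i =
        x0 $ i + RL_integral (\<alpha> $ i) (\<lambda>s. \<Sum>j\<in>UNIV. A $ i $ j * x s $ j) t)"

text \<open>
  The multi-indices \<open>(l\<^sub>\<mu>)\<close> for \<open>\<mu> \<noteq> j\<close>; extensionality makes each of them occur exactly once.
\<close>
definition multi_indices :: "'n \<Rightarrow> ('n \<Rightarrow> nat) set" where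
  "multi_indices j = (UNIV - {j}) \<rightarrow>\<^sub>E UNIV"

definition series_term ::
    "real ^ 'n \<Rightarrow> 'n \<Rightarrow> (nat \<Rightarrow> ('n \<Rightarrow> nat) \<Rightarrow> complex) \<Rightarrow> real \<Rightarrow> nat \<Rightarrow> ('n \<Rightarrow> nat) \<Rightarrow> complex" where
  "series_term \<alpha> j b t k l =
     b k l * of_real (rpow t (real k * \<alpha> $ j + (\<Sum>\<mu>\<in>UNIV - {j}. real (l \<mu>) * \<alpha> $ \<mu>)))"

end

theory Submission
  imports Defs
begin

text \<open>
  The Riemann--Liouville integral of order \<open>a\<close> maps \<open>t powr p / Gamma (1 + p)\<close> to
  \<open>t powr (p + a) / Gamma (1 + p + a)\<close>, so Picard iteration from \<open>x0\<close> produces a series in the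
  monomials \<open>t powr (\<Sum>\<mu>. m \<mu> * \<alpha> $ \<mu>)\<close> whose coefficients satisfy a linear recursion in the
  multi-index \<open>m\<close>. As \<open>Gamma (1 + s) \<ge> R powr s * exp (- R)\<close> for every \<open>R > 0\<close>, a large \<open>R\<close>
  bounds the terms by a geometric series in \<open>m\<close>, uniformly for \<open>t\<close> in a compact interval; hence
  the series may be integrated termwise and solves the Volterra equation. For uniqueness, the
  maximum on \<open>[0,T]\<close> of \<open>exp (- c * t) * norm (z t)\<close>, where \<open>z\<close> is the difference of two solutions
  and \<open>c\<close> is large, is at most half of itself.
\<close>

section \<open>Powers and the Riemann-Liouville integral\<close>

lemma rpow_nonneg [simp]: "0 \<le> rpow t p"
  by (simp add: rpow_def)

lemma rpow_eq_powr: "t > 0 \<Longrightarrow> rpow t p = t powr p"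
  by (simp add: rpow_def)

lemma continuous_on_rpow: "p \<ge> 0 \<Longrightarrow> continuous_on {0..} (\<lambda>t. rpow t p)"
  by (cases "p = 0") (auto simp: rpow_def intro!: continuous_on_powr' continuous_on_id continuous_on_const)

lemma rpow_mono: "0 \<le> p \<Longrightarrow> 0 \<le> s \<Longrightarrow> s \<le> t \<Longrightarrow> rpow s p \<le> rpow t p"
  by (simp add: rpow_def powr_mono2)

text \<open>The substitution \<open>s = t * u\<close> turns this into the Beta integral with
  parameters \<open>p + 1\<close> and \<open>a\<close>.\<close>

lemma kernel_power_has_integral:
  assumes a: "0 < a" and p: "0 \<le> p" and t: "0 \<le> t"
  shows "((\<lambda>s. rpow (t - s) (a - 1) * rpow s p) has_integral
           Gamma a * Gamma (1 + p) / Gamma (1 + (p + a)) * rpow t (p + a)) {0..t}"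
proof (cases "t = 0")
  case True
  have "rpow t (p + a) = 0"
    using a p True by (simp add: rpow_def)
  moreover have "((\<lambda>s. rpow (t - s) (a - 1) * rpow s p) has_integral 0) {0..t}"
    using True has_integral_refl(2)[of _ 0] by simp
  ultimately show ?thesis
    by simp
next
  case False
  with t have t: "0 < t" by simp
  have "((\<lambda>u. u powr (p + 1 - 1) * (1 - u) powr (a - 1)) has_integral Beta (p + 1) a) {0..1}"
    using a p by (intro has_integral_Beta_real) auto
  from has_integral_affinity'[OF this[folded cbox_interval], of "1 / t" 0] t
  have "((\<lambda>s. (s / t) powr p * (1 - s / t) powr (a - 1)) has_integral t * Beta (p + 1) a) {0..t}"
    by simp
  from has_integral_mult_right[OF this, of "t powr (p + a - 1)"]
  have "((\<lambda>s. t powr (p + a - 1) * ((s / t) powr p * (1 - s / t) powr (a - 1))) has_integral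
          t powr (p + a - 1) * (t * Beta (p + 1) a)) {0..t}" .
  then have "((\<lambda>s. t powr (p + a - 1) * ((s / t) powr p * (1 - s / t) powr (a - 1))) has_integral
          Gamma a * Gamma (1 + p) / Gamma (1 + (p + a)) * rpow t (p + a)) {0..t}"
  proof (rule has_integral_eq_rhs)
    show "Gamma a * Gamma (1 + p) / Gamma (1 + (p + a)) * rpow t (p + a) =
        t powr (p + a - 1) * (t * Beta (p + 1) a)"
      using t a p by (simp add: Beta_def rpow_eq_powr powr_diff add_ac mult_ac)
  qed
  \<comment> \<open>The endpoints are left out because \<open>rpow\<close> and \<open>powr\<close>
    differ at base 0 when the exponent is 0.\<close>
  then show ?thesis
  proof (rule has_integral_spike_finite[where S = "{0, t}", rotated -1])
    show "rpow (t - s) (a - 1) * rpow s p =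
      t powr (p + a - 1) * ((s / t) powr p * (1 - s / t) powr (a - 1))"
    if "s \<in> {0..t} - {0, t}" for s
    proof -
    have s: "0 < s" "s < t" using that by auto
    have "1 - s / t = (t - s) / t" using t by (simp add: field_simps)
    moreover have "t powr (p + a - 1) = t powr p * t powr (a - 1)"
      using t by (simp flip: powr_add add: algebra_simps)
    ultimately show ?thesis
      using s t by (simp add: rpow_eq_powr powr_divide)
  qed
  qed auto
qed

lemma kernel_absolutely_integrable:
  assumes "0 < a" "0 \<le> t"
  shows "(\<lambda>s. rpow (t - s) (a - 1)) absolutely_integrable_on {0..t}"
  using kernel_power_has_integral[OF assms(1) _ assms(2), of 0]
  by (intro nonnegative_absolutely_integrable_1) (auto simp: rpow_def integrable_on_def)

text \<open>The kernel may be singular at \<open>s = t\<close> but is absolutely integrable, and a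
  continuous function on a compact interval is bounded and measurable.\<close>

lemma kernel_times_continuous_integrable:
  fixes f :: "real \<Rightarrow> 'a::euclidean_space"
  assumes "0 < a" "0 \<le> t" "continuous_on {0..t} f"
  shows "(\<lambda>s. rpow (t - s) (a - 1) *\<^sub>R f s) integrable_on {0..t}"
proof -
  \<comment> \<open>The factors are swapped because the product rule expects the bounded measurable
    one first.\<close>
  have "(\<lambda>s. (\<lambda>v r. r *\<^sub>R v) (f s) (rpow (t - s) (a - 1))) absolutely_integrable_on {0..t}"
  proof (rule absolutely_integrable_bounded_measurable_product[where h = "\<lambda>v r. r *\<^sub>R v"])
    show "bilinear (\<lambda>(v::'a) (r::real). r *\<^sub>R v)"
      by (auto simp: bilinear_def linear_iff algebra_simps)
    show "f \<in> borel_measurable (lebesgue_on {0..t})"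
      using assms by (intro continuous_imp_measurable_on_sets_lebesgue) auto
    show "bounded (f ` {0..t})"
      using assms by (intro compact_imp_bounded compact_continuous_image) auto
  qed (use assms kernel_absolutely_integrable in auto)
  then show ?thesis
    by (rule set_lebesgue_integral_eq_integral(1))
qed

lemma norm_RL_integral_le:
  assumes "0 < a" "0 \<le> t" "continuous_on {0..t} f" "continuous_on {0..t} g"
    and "\<And>s. s \<in> {0..t} \<Longrightarrow> norm (f s) \<le> g s"
  shows "norm (RL_integral a f t) \<le> integral {0..t} (\<lambda>s. rpow (t - s) (a - 1) * g s) / Gamma a"
proof -
  have "norm (integral {0..t} (\<lambda>s. rpow (t - s) (a - 1) *\<^sub>R f s)) \<le>
          integral {0..t} (\<lambda>s. rpow (t - s) (a - 1) *\<^sub>R g s)"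
    using assms
    by (intro integral_norm_bound_integral kernel_times_continuous_integrable)
       (auto intro: mult_left_mono)
  then show ?thesis
    using Gamma_real_pos[OF assms(1)] by (simp add: RL_integral_def divide_right_mono)
qed

text \<open>Integrating the kernel alone, the case \<open>p = 0\<close> of the Beta integral, bounds
  the operator in the supremum norm.\<close>

lemma norm_RL_integral_le_const:
  assumes "0 < a" "0 \<le> t" "continuous_on {0..t} f"
    and "\<And>s. s \<in> {0..t} \<Longrightarrow> norm (f s) \<le> C"
  shows "norm (RL_integral a f t) \<le> C * rpow t a / Gamma (1 + a)"
proof -
  have "((\<lambda>s. rpow (t - s) (a - 1) * C) has_integral Gamma a / Gamma (1 + a) * rpow t a * C) {0..t}"
    using has_integral_mult_left[OF kernel_power_has_integral[OF assms(1) _ assms(2), of 0], of C]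
    by (simp add: rpow_def[of _ 0])
  then have eq: "integral {0..t} (\<lambda>s. rpow (t - s) (a - 1) * C) = Gamma a / Gamma (1 + a) * rpow t a * C"
    by (rule integral_unique)
  have "Gamma a > 0"
    using assms(1) by (rule Gamma_real_pos)
  then show ?thesis
    using norm_RL_integral_le[OF assms(1-3) continuous_on_const assms(4), unfolded eq]
    by (simp add: mult_ac)
qed

text \<open>Dividing by \<open>Gamma (1 + p)\<close> cancels the Gamma factors of the Beta integral,
  so integration only shifts the exponent and leaves the coefficient \<open>c\<close> alone.\<close>

lemma RL_integral_rpow:
  assumes "0 < a" "0 \<le> p" "0 \<le> t"
  shows "RL_integral a (\<lambda>s. c * of_real (rpow s p / Gamma (1 + p))) t =
           c * of_real (rpow t (p + a) / Gamma (1 + (p + a)))"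
proof -
  have "((\<lambda>s. c * of_real (rpow (t - s) (a - 1) * rpow s p / Gamma (1 + p))) has_integral
      c * of_real (Gamma a * Gamma (1 + p) / Gamma (1 + (p + a)) * rpow t (p + a) / Gamma (1 + p))) {0..t}"
    by (intro has_integral_divide has_integral_mult_right has_integral_of_real
        kernel_power_has_integral assms)
  also have "(\<lambda>s. c * of_real (rpow (t - s) (a - 1) * rpow s p / Gamma (1 + p))) =
      (\<lambda>s. rpow (t - s) (a - 1) *\<^sub>R (c * of_real (rpow s p / Gamma (1 + p))))"
    by (simp add: fun_eq_iff scaleR_conv_of_real)
  finally have "integral {0..t} (\<lambda>s. rpow (t - s) (a - 1) *\<^sub>R (c * of_real (rpow s p / Gamma (1 + p)))) =
      c * of_real (Gamma a * Gamma (1 + p) / Gamma (1 + (p + a)) * rpow t (p + a) / Gamma (1 + p))"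
    by (rule integral_unique)
  moreover have "Gamma a > 0" "Gamma (1 + p) > 0"
    using assms by (auto intro: Gamma_real_pos)
  ultimately show ?thesis
    unfolding RL_integral_def by (simp only:) (simp add: scaleR_conv_of_real)
qed

lemma RL_integral_diff:
  assumes "0 < a" "0 \<le> t" "continuous_on {0..t} f" "continuous_on {0..t} g"
  shows "RL_integral a (\<lambda>s. f s - g s) t = RL_integral a f t - RL_integral a g t"
  unfolding RL_integral_def scaleR_diff_right
  by (subst integral_diff) (use assms in \<open>auto simp: scaleR_diff_right intro: kernel_times_continuous_integrable\<close>)

lemma RL_integral_sum:
  assumes "0 < a" "0 \<le> t" "\<And>m. m \<in> F \<Longrightarrow> continuous_on {0..t} (f m)" "finite F"
  shows "RL_integral a (\<lambda>s. \<Sum>m\<in>F. f m s) t = (\<Sum>m\<in>F. RL_integral a (f m) t)"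
  unfolding RL_integral_def scaleR_sum_right
  by (subst integral_sum) (use assms in \<open>auto simp: scaleR_sum_right intro: kernel_times_continuous_integrable\<close>)

text \<open>The Weierstrass test makes the finite partial sums converge uniformly to
  \<open>h\<close>, and the integral at \<open>t\<close> is bounded in the supremum norm, so it
  respects this limit.\<close>

lemma RL_integral_has_sum:
  assumes a: "0 < a" and t: "0 \<le> t"
    and cont: "\<And>m. continuous_on {0..t} (f m)"
    and bound: "\<And>m s. s \<in> {0..t} \<Longrightarrow> norm (f m s) \<le> g m" and g: "g summable_on UNIV"
    and sum: "\<And>s. s \<in> {0..t} \<Longrightarrow> ((\<lambda>m. f m s) has_sum h s) UNIV"
  shows "((\<lambda>m. RL_integral a (f m) t) has_sum RL_integral a h t) UNIV"
proof -
  have lim: "uniform_limit {0..t} (\<lambda>F s. \<Sum>m\<in>F. f m s) h (finite_subsets_at_top UNIV)"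
    using bound sum g by (intro Weierstrass_m_test_general') auto
  have conth: "continuous_on {0..t} h"
    using cont by (intro uniform_limit_theorem[OF _ lim]) (auto intro!: always_eventually continuous_intros)
  define K where "K = rpow t a / Gamma (1 + a)"
  have K: "K \<ge> 0"
    using a by (auto simp: K_def intro!: divide_nonneg_nonneg less_imp_le[OF Gamma_real_pos])
  show ?thesis
    unfolding has_sum_def
  proof (rule tendstoI)
    fix e :: real
    assume e: "e > 0"
    \<comment> \<open>\<open>K\<close> bounds the operator at \<open>t\<close>. It vanishes for
      \<open>t = 0\<close>, hence the division by \<open>K + 1\<close>.\<close>
    then have "e / (K + 1) > 0" using K by simp
    note uniform_limitD[OF lim this]
    moreover have "\<forall>\<^sub>F F in finite_subsets_at_top UNIV. finite F"
      by (rule eventually_finite_subsets_at_top_weakI)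
    ultimately show "\<forall>\<^sub>F F in finite_subsets_at_top UNIV.
        dist (\<Sum>m\<in>F. RL_integral a (f m) t) (RL_integral a h t) < e"
    proof eventually_elim
      case (elim F)
      have "dist (\<Sum>m\<in>F. RL_integral a (f m) t) (RL_integral a h t) =
          norm (RL_integral a (\<lambda>s. (\<Sum>m\<in>F. f m s) - h s) t)"
        using elim a t cont conth
        by (simp add: RL_integral_diff RL_integral_sum dist_norm continuous_on_sum)
      also have "\<dots> \<le> e / (K + 1) * rpow t a / Gamma (1 + a)"
        using elim a t cont conth
        by (intro norm_RL_integral_le_const) (auto simp: dist_norm intro!: continuous_intros less_imp_le)
      also have "\<dots> = e * (K / (K + 1))"
        by (simp add: K_def)
      also have "\<dots> < e"
        using e K by (simp add: field_simps)
      finally show ?case .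
    qed
  qed
qed

section \<open>Estimates for uniqueness and for convergence\<close>

lemma kernel_exp_integral_le:
  assumes a: "0 < a" and c: "0 < c" and t: "0 \<le> t"
  shows "integral {0..t} (\<lambda>s. rpow (t - s) (a - 1) * exp (c * s)) \<le> Gamma a * c powr (- a) * exp (c * t)"
proof -
  \<comment> \<open>Substituting \<open>u = c * (t - s)\<close> leaves an incomplete Gamma integral
    over \<open>{0..c * t}\<close>, which is at most \<open>Gamma a\<close>. The factor
    \<open>c powr (- a)\<close> gained here makes the uniqueness argument contract.\<close>
  define f where "f = (\<lambda>u::real. u powr (a - 1) / exp u)"
  have f: "(f has_integral Gamma a) {0..}"
    unfolding f_def using a by (rule Gamma_integral_real)
  have fi: "f integrable_on {0..c * t}"
    by (rule integrable_on_subinterval[of _ "{0..}"]) (use f in \<open>auto simp: integrable_on_def\<close>)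
  have le: "integral {0..c * t} f \<le> Gamma a"
    using f fi integral_subset_le[of "{0..c * t}" "{0..}" f]
    by (auto simp: integral_unique integrable_on_def f_def)
  have img: "(\<lambda>x. (1 / - c) *\<^sub>R x + - ((1 / - c) *\<^sub>R (c * t))) ` {0..c * t} = {0..t}"
    using c t image_affinity_atLeastAtMost[of "- (1 / c)" t 0 "c * t"] by simp
  have "((\<lambda>s. f (- c * s + c * t)) has_integral (1 / c) * integral {0..c * t} f) {0..t}"
    using has_integral_affinity[OF integrable_integral[OF fi, folded cbox_interval], of "- c" "c * t"] c img
    by simp
  from has_integral_mult_right[OF this, of "c powr (1 - a) * exp (c * t)"]
  have "((\<lambda>s. c powr (1 - a) * exp (c * t) * f (- c * s + c * t)) has_integral
     c powr (1 - a) * exp (c * t) * ((1 / c) * integral {0..c * t} f)) {0..t}" .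
  \<comment> \<open>For \<open>a = 1\<close> the two integrands differ at \<open>s = t\<close>,
    where \<open>rpow\<close> gives 1 and \<open>f\<close> gives 0.\<close>
  then have "((\<lambda>s. rpow (t - s) (a - 1) * exp (c * s)) has_integral
     c powr (1 - a) * exp (c * t) * ((1 / c) * integral {0..c * t} f)) {0..t}"
  proof (rule has_integral_spike_finite[where S = "{t}", rotated -1])
    show "rpow (t - s) (a - 1) * exp (c * s) = c powr (1 - a) * exp (c * t) * f (- c * s + c * t)"
    if "s \<in> {0..t} - {t}" for s
  proof -
    have s: "0 \<le> s" "s < t" using that by auto
    have "- c * s + c * t = c * (t - s)" by (simp add: algebra_simps)
    moreover have "c powr (1 - a) * c powr (a - 1) = 1"
      using c by (simp flip: powr_add)
    moreover have "exp (c * t) = exp (c * (t - s)) * exp (c * s)"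
      by (simp add: algebra_simps flip: exp_add)
    ultimately show ?thesis
      using s c by (simp add: rpow_eq_powr f_def powr_mult)
  qed
  qed auto
  then have "integral {0..t} (\<lambda>s. rpow (t - s) (a - 1) * exp (c * s)) =
     integral {0..c * t} f * (c powr (- a) * exp (c * t))"
    using c by (simp add: integral_unique powr_diff powr_minus divide_simps)
  also have "\<dots> \<le> Gamma a * (c powr (- a) * exp (c * t))"
    using le by (intro mult_right_mono) auto
  finally show ?thesis by (simp add: mult_ac)
qed

text \<open>In the Gamma integral, drop the part below \<open>R\<close> and use
  \<open>u powr s \<ge> R powr s\<close> on the rest.\<close>

lemma Gamma_ge_powr:
  assumes R: "0 < R" and s: "0 \<le> s"
  shows "R powr s * exp (- R) \<le> Gamma (1 + s :: real)"
proof -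
  have 1: "((\<lambda>u. exp (- 1 * u)) has_integral exp (- 1 * R) / 1) {R..}"
    by (rule has_integral_exp_minus_to_infinity) simp
  have 2: "((\<lambda>u. if u \<in> {R..} then R powr s * exp (- u) else 0) has_integral R powr s * exp (- R)) {0..}"
    using has_integral_mult_right[OF 1, of "R powr s"] R by (subst has_integral_restrict) auto
  have 3: "((\<lambda>u. u powr s / exp u) has_integral Gamma (1 + s)) {0..}"
    using Gamma_integral_real[of "1 + s"] s by simp
  from 2 3 show ?thesis
    by (rule has_integral_le) (use R s in \<open>auto simp: exp_minus divide_simps intro!: powr_mono2\<close>)
qed

text \<open>A finite set of multi-indices lies in a box, and the sum over a box factors into partial
  sums of the one-dimensional geometric series.\<close>

lemma geometric_multiindex_summable:
  fixes q :: real
  assumes "0 \<le> q" "q < 1"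
  shows "(\<lambda>m :: 'n::finite \<Rightarrow> nat. \<Prod>\<mu>\<in>UNIV. q ^ m \<mu>) summable_on UNIV"
proof (rule nonneg_bdd_above_summable_on)
  show "bdd_above (sum (\<lambda>m :: 'n \<Rightarrow> nat. \<Prod>\<mu>\<in>UNIV. q ^ m \<mu>) ` {F. F \<subseteq> UNIV \<and> finite F})"
  proof (rule bdd_aboveI2)
    fix F :: "('n \<Rightarrow> nat) set"
    assume "F \<in> {F. F \<subseteq> UNIV \<and> finite F}"
    then have F: "finite F" by simp
    define N where "N = Max (insert 0 ((\<lambda>(m, \<mu>). m \<mu>) ` (F \<times> UNIV)))"
    have "m \<mu> \<le> N" if "m \<in> F" for m \<mu>
      unfolding N_def using F that by (intro Max_ge) force+
    then have sub: "F \<subseteq> PiE UNIV (\<lambda>_. {..N})"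
      by (auto simp: PiE_def)
    have "(\<Sum>m\<in>F. \<Prod>\<mu>\<in>UNIV. q ^ m \<mu>) \<le> (\<Sum>m\<in>PiE UNIV (\<lambda>_::'n. {..N}). \<Prod>\<mu>\<in>UNIV. q ^ m \<mu>)"
      using sub assms by (intro sum_mono2 finite_PiE) (auto intro: prod_nonneg)
    also have "\<dots> = (\<Prod>\<mu>\<in>(UNIV::'n set). \<Sum>k\<le>N. q ^ k)"
      by (rule prod_sum_PiE[symmetric]) auto
    also have "\<dots> \<le> (\<Prod>\<mu>\<in>(UNIV::'n set). 1 / (1 - q))"
    proof (intro prod_mono conjI)
      show "(\<Sum>k\<le>N. q ^ k) \<le> 1 / (1 - q)"
        using sum_le_suminf[of "(^) q" "{..N}"] assms by (simp add: suminf_geometric summable_geometric)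
    qed (use assms in \<open>auto intro: sum_nonneg\<close>)
    finally show "(\<Sum>m\<in>F. \<Prod>\<mu>\<in>UNIV. q ^ m \<mu>) \<le> (\<Prod>\<mu>\<in>(UNIV::'n set). 1 / (1 - q))" .
  qed
qed (use assms in \<open>auto intro: prod_nonneg\<close>)

lemma has_sum_sum_finite:
  fixes f :: "'a \<Rightarrow> 'b \<Rightarrow> 'c::topological_comm_monoid_add"
  assumes "finite J" "\<And>j. j \<in> J \<Longrightarrow> (f j has_sum s j) X"
  shows "((\<lambda>x. \<Sum>j\<in>J. f j x) has_sum (\<Sum>j\<in>J. s j)) X"
  using assms by (induction J) (auto intro: has_sum_add)

section \<open>Exponents and coefficients of the series\<close>

definition weight :: "real ^ 'n \<Rightarrow> ('n \<Rightarrow> nat) \<Rightarrow> real" where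
  "weight \<alpha> m = (\<Sum>\<mu>\<in>UNIV. real (m \<mu>) * \<alpha> $ \<mu>)"

lemma weight_zero [simp]: "weight \<alpha> (\<lambda>_. 0) = 0"
  by (simp add: weight_def)

lemma weight_nonneg: "(\<And>i. 0 < \<alpha> $ i) \<Longrightarrow> 0 \<le> weight \<alpha> m"
  unfolding weight_def by (intro sum_nonneg mult_nonneg_nonneg) (auto intro: less_imp_le)

text \<open>Singles out the \<open>j\<close>-th entry, which gives the exponent the shape it has in
  \<open>series_term\<close>.\<close>

lemma weight_upd: "weight \<alpha> (m(j := k)) = real k * \<alpha> $ j + (\<Sum>\<mu>\<in>UNIV - {j}. real (m \<mu>) * \<alpha> $ \<mu>)"
  unfolding weight_def by (subst sum.remove[of _ j]) auto

lemma weight_upd_Suc: "weight \<alpha> (m(i := Suc (m i))) = weight \<alpha> m + \<alpha> $ i"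
  using weight_upd[of \<alpha> m i "m i"] by (simp add: weight_upd algebra_simps)

text \<open>
  The coefficient of \<open>t powr weight \<alpha> m / Gamma (1 + weight \<alpha> m)\<close> in the \<open>i\<close>-th component.
  Integrating the \<open>i\<close>-th equation raises only the \<open>i\<close>-th entry of \<open>m\<close>.
\<close>
function mcoeff :: "complex ^ 'n ^ 'n \<Rightarrow> complex ^ 'n \<Rightarrow> ('n \<Rightarrow> nat) \<Rightarrow> 'n \<Rightarrow> complex" where
  "mcoeff A x0 m i =
     (if m = (\<lambda>_. 0) then x0 $ i
      else if m i = 0 then 0
      else (\<Sum>j\<in>UNIV. A $ i $ j * mcoeff A x0 (m(i := m i - 1)) j))"
  by pat_completeness auto
termination
proof (relation "Wellfounded.measure (\<lambda>(A, x0, m, i). sum m UNIV)", goal_cases)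
  case (2 A x0 m i j)
  have "sum (m(i := m i - 1)) UNIV < sum m UNIV"
    using 2 by (intro sum_strict_mono_ex1) auto
  then show ?case by simp
qed simp

declare mcoeff.simps [simp del]

lemma mcoeff_zero: "mcoeff A x0 (\<lambda>_. 0) i = x0 $ i"
  by (simp add: mcoeff.simps)

lemma mcoeff_eq_0: "m \<noteq> (\<lambda>_. 0) \<Longrightarrow> m i = 0 \<Longrightarrow> mcoeff A x0 m i = 0"
  by (simp add: mcoeff.simps)

lemma mcoeff_upd_Suc:
  "mcoeff A x0 (m(i := Suc (m i))) i = (\<Sum>j\<in>UNIV. A $ i $ j * mcoeff A x0 m j)"
proof -
  have "m(i := Suc (m i)) \<noteq> (\<lambda>_. 0)"
    by (metis fun_upd_same nat.distinct(1))
  then show ?thesis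
    by (subst mcoeff.simps) simp
qed

text \<open>Each step of the recursion lowers the total degree by one and costs at most one row sum
  of \<open>A\<close>.\<close>

lemma norm_mcoeff_le:
  fixes A :: "complex ^ 'n ^ 'n"
  assumes M: "0 \<le> M" "\<And>i. (\<Sum>j\<in>UNIV. norm (A $ i $ j)) \<le> M"
  shows "norm (mcoeff A x0 m i) \<le> norm x0 * M ^ sum m UNIV"
  \<comment> \<open>The row-sum bound enters the induction because \<open>A\<close> is one of the
    induction variables.\<close>
  using M(2)
proof (induction A x0 m i rule: mcoeff.induct)
  case (1 A x0 m i)
  consider "m = (\<lambda>_. 0)" | "m \<noteq> (\<lambda>_. 0)" "m i = 0" | "m i \<noteq> 0" by blast
  then show ?case
  proof cases
    case 1
    then show ?thesis
      by (simp add: mcoeff_zero Finite_Cartesian_Product.norm_nth_le)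
  next
    case 2
    then show ?thesis
      using M(1) by (simp add: mcoeff_eq_0)
  next
    case 3
    define m' where "m' = m(i := m i - 1)"
    have m: "m = m'(i := Suc (m' i))"
      using 3 by (auto simp: m'_def)
    have "sum m UNIV = Suc (sum m' UNIV)"
      using 3 by (simp add: m'_def sum.remove[of UNIV i])
    moreover have "norm (mcoeff A x0 m i) \<le> (\<Sum>j\<in>UNIV. norm (A $ i $ j) * (norm x0 * M ^ sum m' UNIV))"
    proof (subst m, unfold mcoeff_upd_Suc, rule sum_norm_le)
      fix j
      have "norm (mcoeff A x0 m' j) \<le> norm x0 * M ^ sum m' UNIV"
        unfolding m'_def using 3 by (intro "1.IH" "1.prems") auto
      then show "norm (A $ i $ j * mcoeff A x0 m' j) \<le> norm (A $ i $ j) * (norm x0 * M ^ sum m' UNIV)"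
        by (simp add: norm_mult mult_left_mono)
    qed
    moreover have "\<dots> \<le> M * (norm x0 * M ^ sum m' UNIV)"
      unfolding sum_distrib_right[symmetric]
      using "1.prems" M(1) by (intro mult_right_mono) auto
    ultimately show ?thesis
      by (simp add: mult_ac)
  qed
qed

section \<open>Convergence and continuity of the series\<close>

definition series_summand ::
    "real ^ 'n \<Rightarrow> complex ^ 'n ^ 'n \<Rightarrow> complex ^ 'n \<Rightarrow> 'n \<Rightarrow> real \<Rightarrow> ('n \<Rightarrow> nat) \<Rightarrow> complex" where
  "series_summand \<alpha> A x0 i t m =
     mcoeff A x0 m i * of_real (rpow t (weight \<alpha> m) / Gamma (1 + weight \<alpha> m))"

definition series_solution ::
    "real ^ 'n \<Rightarrow> complex ^ 'n ^ 'n \<Rightarrow> complex ^ 'n \<Rightarrow> real \<Rightarrow> complex ^ 'n" where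
  "series_solution \<alpha> A x0 t = (\<chi> i. \<Sum>\<^sub>\<infinity>m. series_summand \<alpha> A x0 i t m)"

text \<open>The majorant is independent of \<open>i\<close> and of \<open>t\<close> in
  \<open>{0..T}\<close>, so it serves absolute convergence, continuity and termwise integration
  alike.\<close>

lemma series_summand_majorant:
  fixes \<alpha> :: "real ^ 'n"
  assumes \<alpha>: "\<And>i. 0 < \<alpha> $ i"
  obtains g where "g summable_on UNIV"
    and "\<And>i t m. t \<in> {0..T} \<Longrightarrow> norm (series_summand \<alpha> A x0 i t m) \<le> g m"
proof -
  \<comment> \<open>A positive bound makes \<open>rpow T' w\<close> and \<open>T' powr w\<close>
    agree even for \<open>w = 0\<close>.\<close>
  define T' where "T' = max T 1"
  have T': "0 < T'" "T \<le> T'" by (auto simp: T'_def)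
  define M where "M = (\<Sum>i\<in>UNIV. \<Sum>j\<in>UNIV. norm (A $ i $ j))"
  have M: "(\<Sum>j\<in>UNIV. norm (A $ i $ j)) \<le> M" for i
    unfolding M_def by (rule member_le_sum) (auto intro: sum_nonneg)
  have M0: "0 \<le> M"
    unfolding M_def by (intro sum_nonneg) auto
  \<comment> \<open>Since every \<open>\<alpha> $ i\<close> is positive and there are finitely many,
    one large \<open>R\<close> makes all these factors smaller than \<open>1 / 2\<close>.\<close>
  have "\<forall>\<^sub>F R in at_top. M * T' powr \<alpha> $ i * R powr (- \<alpha> $ i) < 1 / 2" for i
  proof (rule order_tendstoD(2))
    show "((\<lambda>R. M * T' powr \<alpha> $ i * R powr (- \<alpha> $ i)) \<longlongrightarrow> M * T' powr \<alpha> $ i * 0) at_top"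
      using \<alpha>[of i] by (intro tendsto_mult_left tendsto_neg_powr filterlim_ident) simp
  qed auto
  then have "\<forall>\<^sub>F R in at_top. (\<forall>i. M * T' powr \<alpha> $ i * R powr (- \<alpha> $ i) < 1 / 2) \<and> 0 < R"
    by (intro eventually_conj eventually_all_finite eventually_gt_at_top)
  then obtain R where "0 < R" "\<And>i. M * T' powr \<alpha> $ i * R powr (- \<alpha> $ i) < 1 / 2"
    by (auto dest!: eventually_happens)
  with T' have R: "0 < R" "\<And>i. M * (T' / R) powr \<alpha> $ i < 1 / 2"
    by (auto simp: powr_divide powr_minus_divide)
  define g where "g = (\<lambda>m. norm x0 * exp R * (\<Prod>\<mu>\<in>(UNIV::'n set). (1 / 2) ^ m \<mu>))"
  show ?thesis
  proof
    show "g summable_on UNIV"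
      unfolding g_def by (intro summable_on_cmult_right geometric_multiindex_summable) auto
    fix i :: 'n and t :: real and m :: "'n \<Rightarrow> nat"
    assume t: "t \<in> {0..T}"
    define w where "w = weight \<alpha> m"
    have w: "0 \<le> w" unfolding w_def using \<alpha> by (rule weight_nonneg)
    have "norm (series_summand \<alpha> A x0 i t m) = norm (mcoeff A x0 m i) * (rpow t w / Gamma (1 + w))"
      using w by (simp add: series_summand_def w_def[symmetric] norm_mult norm_divide)
    also have "\<dots> \<le> (norm x0 * M ^ sum m UNIV) * (T' powr w / (R powr w * exp (- R)))"
      using M M0 t T' R w rpow_mono[of w t T']
      by (intro mult_mono frac_le norm_mcoeff_le Gamma_ge_powr) (auto simp: rpow_eq_powr)
    also have "\<dots> = norm x0 * exp R * (M ^ sum m UNIV * (T' / R) powr w)"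
      using T' R by (simp add: powr_divide exp_minus divide_simps)
    \<comment> \<open>\<open>weight\<close> and the total degree are both linear in
      \<open>m\<close>, so the bound splits into one geometric factor per entry.\<close>
    also have "M ^ sum m UNIV * (T' / R) powr w = (\<Prod>\<mu>\<in>UNIV. (M * (T' / R) powr \<alpha> $ \<mu>) ^ m \<mu>)"
      using T' R
      by (simp add: w_def weight_def powr_sum power_sum power_mult_distrib prod.distrib powr_power mult.commute)
    also have "norm x0 * exp R * \<dots> \<le> g m"
      unfolding g_def using R M0 
      by (intro mult_left_mono prod_mono conjI power_mono) (auto intro: less_imp_le)
    finally show "norm (series_summand \<alpha> A x0 i t m) \<le> g m" .
  qed
qed

lemma series_solution_has_sum:
  assumes "\<And>i. 0 < \<alpha> $ i" "0 \<le> t"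
  shows "(series_summand \<alpha> A x0 i t has_sum series_solution \<alpha> A x0 t $ i) UNIV"
    and "(\<lambda>m. norm (series_summand \<alpha> A x0 i t m)) summable_on UNIV"
proof -
  obtain g where g: "g summable_on UNIV"
    "\<And>i s m. s \<in> {0..t} \<Longrightarrow> norm (series_summand \<alpha> A x0 i s m) \<le> g m"
    using series_summand_majorant[OF assms(1)] by blast
  show *: "(\<lambda>m. norm (series_summand \<alpha> A x0 i t m)) summable_on UNIV"
    using g(1) by (rule Infinite_Sum.abs_summable_on_comparison_test') (use g(2) assms(2) in auto)
  show "(series_summand \<alpha> A x0 i t has_sum series_solution \<alpha> A x0 t $ i) UNIV"
    unfolding series_solution_def using abs_summable_summable[OF *] by simp
qed

lemma continuous_on_series_summand:
  assumes "\<And>i. 0 < \<alpha> $ i"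
  shows "continuous_on {0..} (\<lambda>t. series_summand \<alpha> A x0 i t m)"
proof -
  have "Gamma (1 + weight \<alpha> m) \<noteq> 0"
    using weight_nonneg[OF assms] Gamma_real_pos[of "1 + weight \<alpha> m"] by (metis add_pos_nonneg less_irrefl zero_less_one)
  then show ?thesis
    unfolding series_summand_def using weight_nonneg[OF assms]
    by (intro continuous_intros continuous_on_rpow) auto
qed

lemma continuous_on_series_solution:
  assumes "\<And>i. 0 < \<alpha> $ i"
  shows "continuous_on {0..} (series_solution \<alpha> A x0)"
proof -
  have *: "continuous_on {0..T} (\<lambda>t. series_solution \<alpha> A x0 t $ i)" for T i
  proof -
    obtain g where g: "g summable_on UNIV"
      "\<And>i t m. t \<in> {0..T} \<Longrightarrow> norm (series_summand \<alpha> A x0 i t m) \<le> g m"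
      using series_summand_majorant[OF assms] by blast
    have "uniform_limit {0..T} (\<lambda>F t. \<Sum>m\<in>F. series_summand \<alpha> A x0 i t m)
        (\<lambda>t. series_solution \<alpha> A x0 t $ i) (finite_subsets_at_top UNIV)"
      using g series_solution_has_sum(1)[OF assms]
      by (intro Weierstrass_m_test_general') auto
    then show ?thesis
      by (rule uniform_limit_theorem[rotated])
         (auto intro!: always_eventually continuous_on_sum
            continuous_on_subset[OF continuous_on_series_summand] assms)
  qed
  \<comment> \<open>The majorant works on bounded intervals only, but continuity at \<open>t\<close>
    depends only on values near \<open>t\<close>, and \<open>{0..t+1}\<close> contains
    those.\<close>
  have "continuous (at t within {0..}) (\<lambda>t. series_solution \<alpha> A x0 t $ i)" if "0 \<le> t" for t i
  proof -
    have "continuous (at t within {0..t+1}) (\<lambda>t. series_solution \<alpha> A x0 t $ i)"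
      using *[of "t + 1" i] that by (auto simp: continuous_on_eq_continuous_within)
    moreover have "at t within {0..t+1} = at t within {0..}"
      using that by (intro at_within_nhd[of _ "{..<t+1}"]) auto
    ultimately show ?thesis by simp
  qed
  then have "continuous_on {0..} (\<lambda>t. \<chi> i. series_solution \<alpha> A x0 t $ i)"
    by (intro continuous_on_vec_lambda) (auto simp: continuous_on_eq_continuous_within)
  then show ?thesis by simp
qed

section \<open>Existence: the series solves the Volterra equation\<close>

lemma caputo_ivp_solution_series_solution:
  fixes \<alpha> :: "real ^ 'n"
  assumes \<alpha>: "\<And>i. 0 < \<alpha> $ i"
  shows "caputo_ivp_solution \<alpha> A x0 (series_solution \<alpha> A x0)"
  unfolding caputo_ivp_solution_def
proof (intro conjI allI impI)
  show "continuous_on {0..} (series_solution \<alpha> A x0)"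
    using \<alpha> by (rule continuous_on_series_solution)
next
  fix t :: real and i :: 'n
  assume t: "0 \<le> t"
  define up where "up = (\<lambda>m :: 'n \<Rightarrow> nat. m(i := Suc (m i)))"
  define rhs where "rhs = (\<lambda>s. \<Sum>j\<in>UNIV. A $ i $ j * series_solution \<alpha> A x0 s $ j)"
  define f where "f = (\<lambda>m s. \<Sum>j\<in>UNIV. A $ i $ j * series_summand \<alpha> A x0 j s m)"
  \<comment> \<open>By the coefficient recursion, the \<open>m\<close>-th term of the right-hand
    side is a single monomial carrying the coefficient of index \<open>up m\<close>.\<close>
  have f_eq: "f m = (\<lambda>s. mcoeff A x0 (up m) i * of_real (rpow s (weight \<alpha> m) / Gamma (1 + weight \<alpha> m)))" for m
    unfolding f_def up_def mcoeff_upd_Suc series_summand_def by (simp only: sum_distrib_right mult.assoc)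
  obtain g where g: "g summable_on UNIV"
    "\<And>j s m. s \<in> {0..t} \<Longrightarrow> norm (series_summand \<alpha> A x0 j s m) \<le> g m"
    using series_summand_majorant[OF \<alpha>] by blast
  have "((\<lambda>m. RL_integral (\<alpha> $ i) (f m) t) has_sum RL_integral (\<alpha> $ i) rhs t) UNIV"
  proof (rule RL_integral_has_sum[where g = "\<lambda>m. (\<Sum>j\<in>UNIV. norm (A $ i $ j)) * g m"])
    show "continuous_on {0..t} (f m)" for m
      unfolding f_def
      by (intro continuous_intros continuous_on_subset[OF continuous_on_series_summand] \<alpha>) auto
    show "norm (f m s) \<le> (\<Sum>j\<in>UNIV. norm (A $ i $ j)) * g m" if "s \<in> {0..t}" for m s
      unfolding f_def sum_distrib_right
      by (intro sum_norm_le) (auto simp: norm_mult intro!: mult_left_mono g(2) that)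
    show "((\<lambda>m. f m s) has_sum rhs s) UNIV" if "s \<in> {0..t}" for s
      unfolding f_def rhs_def using that
      by (intro has_sum_sum_finite has_sum_cmult_right series_solution_has_sum \<alpha>) auto
  qed (use \<alpha> t g in \<open>auto intro: summable_on_cmult_right\<close>)
  \<comment> \<open>Integration raises the exponent by \<open>\<alpha> $ i\<close>, which matches
    the raised entry of \<open>up m\<close>.\<close>
  moreover have "RL_integral (\<alpha> $ i) (f m) t = series_summand \<alpha> A x0 i t (up m)" for m
    unfolding f_eq using \<alpha> t weight_nonneg[OF \<alpha>, of m]
    by (subst RL_integral_rpow) (auto simp: series_summand_def up_def weight_upd_Suc)
  ultimately have "((series_summand \<alpha> A x0 i t \<circ> up) has_sum RL_integral (\<alpha> $ i) rhs t) UNIV"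
    by (simp add: o_def)
  moreover have "inj up"
  proof (rule injI)
    fix m m' assume "up m = up m'"
    then have "up m \<mu> = up m' \<mu>" for \<mu> by simp
    then show "m = m'"
      by (auto simp: up_def fun_eq_iff split: if_splits) (metis nat.inject)
  qed
  \<comment> \<open>As \<open>up\<close> is injective, the integral is the part of the series with
    indices in \<open>range up\<close>. The zero index supplies the initial value, and all other
    coefficients vanish.\<close>
  ultimately have "(series_summand \<alpha> A x0 i t has_sum RL_integral (\<alpha> $ i) rhs t) (range up)"
    by (simp add: has_sum_reindex)
  moreover have zero: "(\<lambda>_. 0) \<notin> range up"
    by (auto simp: up_def fun_eq_iff) (metis nat.distinct(1))
  ultimately have "(series_summand \<alpha> A x0 i t has_sum
      series_summand \<alpha> A x0 i t (\<lambda>_. 0) + RL_integral (\<alpha> $ i) rhs t) (insert (\<lambda>_. 0) (range up))"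
    by (intro has_sum_insert)
  \<comment> \<open>At \<open>t = 0\<close> this rests on the convention
    \<open>rpow 0 0 = 1\<close>.\<close>
  moreover have "series_summand \<alpha> A x0 i t (\<lambda>_. 0) = x0 $ i"
    by (simp add: series_summand_def mcoeff_zero rpow_def)
  moreover have "series_summand \<alpha> A x0 i t m = 0" if "m \<notin> insert (\<lambda>_. 0) (range up)" for m
  proof -
    have "m i = 0"
    proof (rule ccontr)
      assume "m i \<noteq> 0"
      then have "m = up (m(i := m i - 1))" by (auto simp: up_def)
      with that show False by blast
    qed
    with that show ?thesis by (simp add: series_summand_def mcoeff_eq_0)
  qed
  moreover from this have "(series_summand \<alpha> A x0 i t has_sum S) (insert (\<lambda>_. 0) (range up)) \<longleftrightarrow>
      (series_summand \<alpha> A x0 i t has_sum S) UNIV" for S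
    by (intro has_sum_cong_neutral) auto
  ultimately have "(series_summand \<alpha> A x0 i t has_sum x0 $ i + RL_integral (\<alpha> $ i) rhs t) UNIV"
    by metis
  with series_solution_has_sum(1)[OF \<alpha> t]
  show "series_solution \<alpha> A x0 t $ i = x0 $ i +
      RL_integral (\<alpha> $ i) (\<lambda>s. \<Sum>j\<in>UNIV. A $ i $ j * series_solution \<alpha> A x0 s $ j) t"
    unfolding rhs_def by (rule has_sum_unique)
qed

section \<open>Uniqueness by an exponentially weighted norm\<close>

lemma caputo_ivp_solution_unique:
  fixes \<alpha> :: "real ^ 'n"
  assumes \<alpha>: "\<And>i. 0 < \<alpha> $ i"
    and x: "caputo_ivp_solution \<alpha> A x0 x" and y: "caputo_ivp_solution \<alpha> A x0 y" and T: "0 \<le> T"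
  shows "x T = y T"
proof -
  define z where "z = (\<lambda>t. x t - y t)"
  define rhs where "rhs = (\<lambda>i s. \<Sum>j\<in>UNIV. A $ i $ j * z s $ j)"
  have cont: "continuous_on {0..t} x" "continuous_on {0..t} y" "continuous_on {0..t} z" for t
    using x y unfolding caputo_ivp_solution_def z_def
    by (auto intro!: continuous_intros intro: continuous_on_subset)
  \<comment> \<open>The initial values cancel, so the difference solves the homogeneous
    equation.\<close>
  have z: "z t $ i = RL_integral (\<alpha> $ i) (rhs i) t" if t: "0 \<le> t" for t i
  proof -
    have "rhs i = (\<lambda>s. (\<Sum>j\<in>UNIV. A $ i $ j * x s $ j) - (\<Sum>j\<in>UNIV. A $ i $ j * y s $ j))"
      by (simp add: rhs_def z_def algebra_simps sum_subtractf)
    then have "RL_integral (\<alpha> $ i) (rhs i) t =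
        RL_integral (\<alpha> $ i) (\<lambda>s. \<Sum>j\<in>UNIV. A $ i $ j * x s $ j) t -
        RL_integral (\<alpha> $ i) (\<lambda>s. \<Sum>j\<in>UNIV. A $ i $ j * y s $ j) t"
      using \<alpha> t cont by (auto intro!: RL_integral_diff continuous_intros)
    then show ?thesis
      using x y t by (simp add: z_def caputo_ivp_solution_def)
  qed
  define M where "M = (\<lambda>i. \<Sum>j\<in>UNIV. norm (A $ i $ j))"
  have M: "0 \<le> M i" for i
    unfolding M_def by (intro sum_nonneg) auto
  have rhs_le: "norm (rhs i s) \<le> M i * norm (z s)" for i s
    unfolding rhs_def M_def sum_distrib_right
    by (intro sum_norm_le) (auto simp: norm_mult intro!: mult_left_mono Finite_Cartesian_Product.norm_nth_le)
  \<comment> \<open>The sum over \<open>i\<close> appears because the norm of \<open>z\<close> is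
    estimated by the sum of the norms of its components.\<close>
  have "((\<lambda>c. \<Sum>i\<in>UNIV. M i * c powr (- \<alpha> $ i)) \<longlongrightarrow> (\<Sum>i\<in>UNIV. M i * 0)) at_top"
    using \<alpha> by (intro tendsto_intros tendsto_neg_powr filterlim_ident) auto
  then have "\<forall>\<^sub>F c in at_top. (\<Sum>i\<in>UNIV. M i * c powr (- \<alpha> $ i)) < 1 / 2"
    by (rule order_tendstoD(2)) simp
  then have "\<forall>\<^sub>F c in at_top. (\<Sum>i\<in>UNIV. M i * c powr (- \<alpha> $ i)) < 1 / 2 \<and> 0 < c"
    by (intro eventually_conj eventually_gt_at_top)
  then obtain c where c: "0 < c" "(\<Sum>i\<in>UNIV. M i * c powr (- \<alpha> $ i)) < 1 / 2"
    by (auto dest!: eventually_happens)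
  have "\<exists>\<tau>\<in>{0..T}. \<forall>s\<in>{0..T}. exp (- c * s) * norm (z s) \<le> exp (- c * \<tau>) * norm (z \<tau>)"
    using T cont by (intro continuous_attains_sup continuous_intros) auto
  then obtain \<tau> where \<tau>: "\<tau> \<in> {0..T}"
    and max: "\<And>s. s \<in> {0..T} \<Longrightarrow> exp (- c * s) * norm (z s) \<le> exp (- c * \<tau>) * norm (z \<tau>)"
    by blast
  define N where "N = exp (- c * \<tau>) * norm (z \<tau>)"
  have N: "0 \<le> N" by (simp add: N_def)
  have z_le: "norm (z s) \<le> N * exp (c * s)" if "s \<in> {0..T}" for s
    using max[OF that, folded N_def] by (simp add: exp_minus field_simps)
  \<comment> \<open>Inserting the bound \<open>N * exp (c * s)\<close> for \<open>norm (z s)\<close>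
    into the integral equation reproduces it at the maximum point, with the small factor
    \<open>c powr (- \<alpha> $ i)\<close>.\<close>
  have "norm (z \<tau> $ i) \<le> M i * c powr (- \<alpha> $ i) * (N * exp (c * \<tau>))" for i
  proof -
    have "norm (z \<tau> $ i) \<le>
        integral {0..\<tau>} (\<lambda>s. rpow (\<tau> - s) (\<alpha> $ i - 1) * (M i * (N * exp (c * s)))) / Gamma (\<alpha> $ i)"
      unfolding z[of \<tau> i, OF \<tau>[unfolded atLeastAtMost_iff, THEN conjunct1]]
    proof (rule norm_RL_integral_le)
      show "norm (rhs i s) \<le> M i * (N * exp (c * s))" if "s \<in> {0..\<tau>}" for s
        using that \<tau> by (intro order_trans[OF rhs_le mult_left_mono[OF z_le M]]) auto
      show "continuous_on {0..\<tau>} (rhs i)"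
        unfolding rhs_def using cont by (intro continuous_intros)
    qed (use \<alpha> \<tau> in \<open>auto intro!: continuous_intros\<close>)
    also have "\<dots> = M i * N * integral {0..\<tau>} (\<lambda>s. rpow (\<tau> - s) (\<alpha> $ i - 1) * exp (c * s)) / Gamma (\<alpha> $ i)"
      unfolding integral_mult_right[symmetric] by (simp only: mult_ac)
    also have "\<dots> \<le> M i * N * (Gamma (\<alpha> $ i) * c powr (- \<alpha> $ i) * exp (c * \<tau>)) / Gamma (\<alpha> $ i)"
      using \<alpha> \<tau> c M N
      by (intro divide_right_mono mult_left_mono kernel_exp_integral_le) (auto intro: less_imp_le)
    also have "\<dots> = M i * c powr (- \<alpha> $ i) * (N * exp (c * \<tau>))"
      using Gamma_real_pos[OF \<alpha>[of i]] by simp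
    finally show ?thesis .
  qed
  then have "norm (z \<tau>) \<le> (\<Sum>i\<in>UNIV. M i * c powr (- \<alpha> $ i) * (N * exp (c * \<tau>)))"
    unfolding norm_vec_def[of "z \<tau>"] by (intro order_trans[OF L2_set_le_sum] sum_mono) auto
  also have "\<dots> = (\<Sum>i\<in>UNIV. M i * c powr (- \<alpha> $ i)) * (N * exp (c * \<tau>))"
    by (simp add: sum_distrib_right)
  also have "\<dots> \<le> 1 / 2 * (N * exp (c * \<tau>))"
    using c N by (intro mult_right_mono mult_nonneg_nonneg) (auto intro: less_imp_le)
  also have "N * exp (c * \<tau>) = norm (z \<tau>)"
    by (simp add: N_def exp_minus)
  \<comment> \<open>The chain says that \<open>norm (z \<tau>)\<close> is at most half of
    itself.\<close>
  finally have "N = 0"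
    by (simp add: N_def)
  with z_le[of T] T have "norm (z T) \<le> 0"
    by simp
  then show ?thesis
    by (simp add: z_def)
qed

section \<open>Passage to the stated form of the series\<close>

lemma bij_betw_multi_indices:
  "bij_betw (\<lambda>(k, l). l(j := k)) (UNIV \<times> multi_indices j) UNIV"
\<comment> \<open>The inverse stores the \<open>j\<close>-th entry separately and puts
  \<open>undefined\<close> in its place, the value that extensionality prescribes there.\<close>
proof (rule bij_betwI[where g = "\<lambda>m. (m j, m(j := undefined))"])
  show "(\<lambda>m. (m j, m(j := undefined))) ((\<lambda>(k, l). l(j := k)) p) = p"
    if p_in: "p \<in> UNIV \<times> multi_indices j" for p
  proof -
    obtain k l where p: "p = (k, l)" "l \<in> multi_indices j"
      using p_in by auto
    then have "l j = undefined"
      by (auto simp: multi_indices_def intro: PiE_arb)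
    then have "l(j := undefined) = l"
      by (metis fun_upd_triv)
    with p show ?thesis by simp
  qed
qed (auto simp: multi_indices_def)

theorem theorem2p6:
  fixes \<alpha> :: "real ^ 'n" and A :: "complex ^ 'n ^ 'n" and x0 :: "complex ^ 'n"
  assumes "\<And>i. 0 < \<alpha> $ i \<and> \<alpha> $ i \<le> 1"
  shows "\<exists>x. caputo_ivp_solution \<alpha> A x0 x \<and>
           (\<forall>y. caputo_ivp_solution \<alpha> A x0 y \<longrightarrow> (\<forall>t\<ge>0. y t = x t)) \<and>
           (\<forall>j. \<exists>b :: nat \<Rightarrow> ('n \<Rightarrow> nat) \<Rightarrow> complex. \<forall>t\<ge>0.
              (\<lambda>(k, l). norm (series_term \<alpha> j b t k l)) summable_on (UNIV \<times> multi_indices j) \<and>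
              x t $ j = (\<Sum>\<^sub>\<infinity>k\<in>UNIV. \<Sum>\<^sub>\<infinity>l\<in>multi_indices j. series_term \<alpha> j b t k l))"
proof (intro exI[of _ "series_solution \<alpha> A x0"] conjI allI impI)
  have \<alpha>: "\<And>i. 0 < \<alpha> $ i" using assms by blast
  show sol: "caputo_ivp_solution \<alpha> A x0 (series_solution \<alpha> A x0)"
    using \<alpha> by (rule caputo_ivp_solution_series_solution)
  show "y t = series_solution \<alpha> A x0 t" if "caputo_ivp_solution \<alpha> A x0 y" "0 \<le> t" for y t
    using caputo_ivp_solution_unique[OF \<alpha> that(1) sol that(2)] .
  fix j
  \<comment> \<open>The Gamma factor is absorbed into the coefficient, leaving a pure power of
    \<open>t\<close>.\<close>
  define b where "b = (\<lambda>k l. mcoeff A x0 (l(j := k)) j / of_real (Gamma (1 + weight \<alpha> (l(j := k)))))"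
  have b: "series_term \<alpha> j b t k l = series_summand \<alpha> A x0 j t (l(j := k))" for t k l
    unfolding series_term_def b_def series_summand_def weight_upd by simp
  \<comment> \<open>A general \<open>h\<close> covers both uses: the norm for absolute convergence,
    the identity for the value.\<close>
  have b_comp: "(\<lambda>p. h (series_summand \<alpha> A x0 j t ((\<lambda>(k, l). l(j := k)) p))) =
      (\<lambda>(k, l). h (series_term \<alpha> j b t k l))" for h :: "complex \<Rightarrow> 'c" and t
    by (auto simp: b)
  show "\<exists>b. \<forall>t\<ge>0.
      (\<lambda>(k, l). norm (series_term \<alpha> j b t k l)) summable_on (UNIV \<times> multi_indices j) \<and>
      series_solution \<alpha> A x0 t $ j = (\<Sum>\<^sub>\<infinity>k\<in>UNIV. \<Sum>\<^sub>\<infinity>l\<in>multi_indices j. series_term \<alpha> j b t k l)"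
  proof (intro exI[of _ b] allI impI conjI)
    fix t :: real
    assume t: "0 \<le> t"
    have "(\<lambda>p. norm (series_summand \<alpha> A x0 j t ((\<lambda>(k, l). l(j := k)) p))) summable_on (UNIV \<times> multi_indices j)"
      by (rule iffD2[OF summable_on_reindex_bij_betw[OF bij_betw_multi_indices,
            of "\<lambda>m. norm (series_summand \<alpha> A x0 j t m)"] series_solution_has_sum(2)[OF \<alpha> t]])
    then show *: "(\<lambda>(k, l). norm (series_term \<alpha> j b t k l)) summable_on (UNIV \<times> multi_indices j)"
      by (simp only: b_comp[of norm t])
    then have "(\<lambda>(k, l). series_term \<alpha> j b t k l) summable_on (UNIV \<times> multi_indices j)"
      by (rule abs_summable_summable[OF iffD1[OF summable_on_cong, rotated]]) auto
    \<comment> \<open>Absolute convergence allows the iterated sum to be read as one sum over pairs,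
      which the bijection then turns into the sum over full multi-indices.\<close>
    then have "(\<Sum>\<^sub>\<infinity>k\<in>UNIV. \<Sum>\<^sub>\<infinity>l\<in>multi_indices j. series_term \<alpha> j b t k l) =
        (\<Sum>\<^sub>\<infinity>(k, l)\<in>UNIV \<times> multi_indices j. series_term \<alpha> j b t k l)"
      by (rule infsum_Sigma'_banach)
    also have "\<dots> = (\<Sum>\<^sub>\<infinity>m. series_summand \<alpha> A x0 j t m)"
      by (simp only: b_comp[of "\<lambda>z. z" t, symmetric] infsum_reindex_bij_betw[OF bij_betw_multi_indices[of j],
          of "\<lambda>m. series_summand \<alpha> A x0 j t m"])
    finally show "series_solution \<alpha> A x0 t $ j =
        (\<Sum>\<^sub>\<infinity>k\<in>UNIV. \<Sum>\<^sub>\<infinity>l\<in>multi_indices j. series_term \<alpha> j b t k l)"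
      by (simp add: series_solution_def)
  qed
qed

end
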